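(* Let $N\geq d+1$ and let $\mathbf{A}=(A_{ij})$ be a real $N\times N$ matrix of rank $d$ with all diagonal entries equal to $1$. Then $$E_p(\mathbf{A})\geq M\left(\frac1{N-d},\,p,\,N\right)\quad\text{if } 1\leq p\leq 2,$$ $$E_p(\mathbf{A})\geq (N-1)^{1-\frac p2}\,M\left(\frac1{N-d},\,p,\,N\right)\quad\text{if } p\geq 2.$$
   Context: For a real $N\times N$ matrix $\mathbf{A}=(A_{ij})$ and $p>0$, the $p$-frame energy is $E_p(\mathbf{A})=\sum_{i\neq j}|A_{ij}|^p$, the sum running over all ordered pairs $(i,j)$ with $i\neq j$. The matrix $\mathbf{A}$ is not assumed symmetric or positive semidefinite. For $p>0$ and $c>1/N$, put $f_{c,p}(t)=\left(\frac{t}{c-t}\right)^{p/2}$ for $t\in[0,c)$, and $$M(c,p,N)=\min\left\{\sum_{i=1}^N f_{c,p}(t_i)\ :\ \sum_{i=1}^N t_i=1,\ t_i\in[0,c)\text{ for all } i\right\}.$$ *)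

theory Defs
  imports "HOL-Analysis.Analysis"
begin

definition frame_energy :: "real \<Rightarrow> real ^ 'n ^ 'n \<Rightarrow> real" where
  "frame_energy p A = (\<Sum>(i, j) \<in> {(i, j). i \<noteq> j}. \<bar>A $ i $ j\<bar> powr p)"

text \<open>
  The function below is meant for \<open>p > 0\<close> and \<open>0 \<le> t < c\<close>; at \<open>t = 0\<close> the library
  convention \<open>0 powr a = 0\<close> gives the intended value \<open>0\<close>.
\<close>

definition f_cp :: "real \<Rightarrow> real \<Rightarrow> real \<Rightarrow> real" where
  "f_cp c p t = (t / (c - t)) powr (p / 2)"

text \<open>
  The minimum is taken over an infinite set of reals, so \<^term>\<open>Min\<close> is not available;
  \<open>LEAST\<close> denotes the smallest element of that set whenever it exists, which is the case for
  \<open>p > 0\<close> and \<open>c > 1 / N\<close>: the admissible set is then nonempty, and the objective is continuous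
  and tends to infinity as some \<open>t i\<close> approaches \<open>c\<close>. For other parameters nothing is claimed.
\<close>

definition M_min :: "real \<Rightarrow> real \<Rightarrow> nat \<Rightarrow> real" where
  "M_min c p N =
     (LEAST v. v \<in> {\<Sum>i = 1..N. f_cp c p (t i) | t :: nat \<Rightarrow> real.
                      (\<Sum>i = 1..N. t i) = 1 \<and> (\<forall>i \<in> {1..N}. t i \<in> {0..<c})})"

end

theory Submission
  imports Defs
begin

text \<open>
  Let \<open>n\<close> be the size of the matrix and let \<open>P\<close> be the orthogonal projection onto the kernel of \<open>A\<close>,
  a subspace of dimension \<open>n - d\<close>.  The diagonal entries of \<open>P\<close> lie in \<open>[0, 1]\<close> and add up to the
  trace \<open>n - d\<close>, so \<open>t i = P i i / (n - d)\<close> has sum \<open>1\<close>, and with \<open>c = 1 / (n - d)\<close> the quotient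
  \<open>t i / (c - t i)\<close> is \<open>P i i / (1 - P i i)\<close>.  These weights are the test point in the definition
  of the minimum.

  The link to \<open>A\<close> is row \<open>i\<close> of the equation \<open>A P = 0\<close>.  Since \<open>A i i = 1\<close>, it says that \<open>- P i i\<close> is
  the sum of \<open>A i j * P j i\<close> over \<open>j \<noteq> i\<close>.  The column \<open>P e\<^sub>i\<close> has squared norm \<open>P i i\<close>, so its part
  off the diagonal has squared norm \<open>P i i - (P i i)\<^sup>2\<close>, and the Cauchy-Schwarz inequality gives
  \<open>P i i / (1 - P i i) \<le> (\<Sum>j\<noteq>i. (A i j)\<^sup>2)\<close>.  Here \<open>P i i < 1\<close>, because \<open>P i i = 1\<close> would place
  the unit vector \<open>e\<^sub>i\<close> in the kernel, against \<open>A i i = 1\<close>.  This is \<open>kernel_vector_row_bound\<close>,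
  applied to the vectors of \<open>orthogonal_projection_columns\<close>.

  Raised to the power \<open>p / 2\<close>, this bounds the sum of \<open>f_cp\<close> over the test point by a sum of
  \<open>p / 2\<close>-th powers of row sums of squares.  These are compared with the row sums of
  \<open>\<bar>A i j\<bar> powr p\<close> by subadditivity of \<open>x powr (p / 2)\<close> if \<open>p \<le> 2\<close> and by the power mean inequality,
  with \<open>n - 1\<close> terms in each row, if \<open>p \<ge> 2\<close>.

  The value \<open>M_min\<close> is given as a least element, so that it bounds the objective from below only
  once a minimum is known to exist.  This is a compactness argument
  (\<open>f_cp_sum_attains_minimum\<close>, transferred to the definition in \<open>M_min_le\<close>): points at which the objective
  stays below its value at the uniform weights keep a positive distance from the pole \<open>c\<close>.
\<close>

section \<open>Comparison of power sums\<close>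

text \<open>
  After division by the total, each term is at most \<open>1\<close>, and a power with exponent at most \<open>1\<close> can
  only increase it.
\<close>

lemma powr_sum_le_sum_powr:
  fixes y :: "'a \<Rightarrow> real"
  assumes "finite I" and y: "\<And>i. i \<in> I \<Longrightarrow> 0 \<le> y i" and q: "0 < q" "q \<le> 1"
  shows "(\<Sum>i\<in>I. y i) powr q \<le> (\<Sum>i\<in>I. y i powr q)"
proof (cases "(\<Sum>i\<in>I. y i) = 0")
  case True
  then show ?thesis by (simp add: sum_nonneg)
next
  case False
  define S where "S = (\<Sum>i\<in>I. y i)"
  have S: "S > 0"
    using False y sum_nonneg[of I y] unfolding S_def by force
  have term_le: "y i / S * S powr q \<le> y i powr q" if "i \<in> I" for i
  proof -
    have "y i \<le> S"
      unfolding S_def using assms(1) y that by (intro member_le_sum) auto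
    then have "y i / S \<le> (y i / S) powr q"
      using powr_mono'[of q 1 "y i / S"] q y[OF that] S by simp
    then have "y i / S * S powr q \<le> (y i / S) powr q * S powr q"
      by (rule mult_right_mono) simp
    also have "\<dots> = y i powr q"
      using S y[OF that] by (simp add: powr_divide)
    finally show ?thesis .
  qed
  have "S powr q = (\<Sum>i\<in>I. y i / S * S powr q)"
    using S by (simp flip: sum_distrib_right sum_divide_distrib S_def)
  also have "\<dots> \<le> (\<Sum>i\<in>I. y i powr q)"
    by (intro sum_mono term_le)
  finally show ?thesis
    by (simp add: S_def)
qed

lemma powr_sum_le_card_mult_sum_powr:
  fixes y :: "'a \<Rightarrow> real"
  assumes "finite I" and y: "\<And>i. i \<in> I \<Longrightarrow> 0 \<le> y i" and q: "1 \<le> q"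
  shows "(\<Sum>i\<in>I. y i) powr q \<le> real (card I) powr (q - 1) * (\<Sum>i\<in>I. y i powr q)"
proof -
  \<comment> \<open>Vanishing terms contribute nothing to the sums, and dropping them brings all the points
    into the open half-line, on which \<open>powr_convex\<close> states convexity.\<close>
  define T where "T = {i \<in> I. y i \<noteq> 0}"
  have T: "finite T" "T \<subseteq> I" and y_pos: "\<And>i. i \<in> T \<Longrightarrow> 0 < y i"
    using assms(1) y by (auto simp: T_def less_le)
  have sums: "(\<Sum>i\<in>I. y i) = (\<Sum>i\<in>T. y i)" "(\<Sum>i\<in>I. y i powr q) = (\<Sum>i\<in>T. y i powr q)"
    using assms(1) by (auto simp: T_def intro!: sum.mono_neutral_right)
  show ?thesis
  proof (cases "T = {}")
    case True
    then show ?thesis by (simp add: sums)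
  next
    case False
    define m where "m = real (card T)"
    have m: "0 < m" "m \<le> real (card I)"
      using False T assms(1) by (auto simp: m_def card_gt_0_iff card_mono)
    have "(\<Sum>i\<in>T. (1 / m) *\<^sub>R y i) powr q \<le> (\<Sum>i\<in>T. (1 / m) * y i powr q)"
      using T False y_pos m
      by (intro convex_on_sum[OF _ _ powr_convex[OF q]]) (auto simp: m_def)
    then have "((\<Sum>i\<in>T. y i) / m) powr q \<le> (\<Sum>i\<in>T. y i powr q) / m"
      by (simp flip: sum_distrib_left sum_divide_distrib)
    then have "(\<Sum>i\<in>T. y i) powr q \<le> m powr (q - 1) * (\<Sum>i\<in>T. y i powr q)"
      using m y_pos by (simp add: powr_divide powr_diff field_simps sum_nonneg less_imp_le)
    also have "\<dots> \<le> real (card I) powr (q - 1) * (\<Sum>i\<in>T. y i powr q)"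
      using m q by (intro mult_right_mono powr_mono2 sum_nonneg) auto
    finally show ?thesis
      by (simp add: sums)
  qed
qed

section \<open>Projection onto the kernel\<close>

lemma dim_kernel_plus_rank:
  fixes A :: "real ^ 'n ^ 'm"
  shows "dim {x. A *v x = 0} + rank A = CARD('n)"
proof -
  have "{x. A *v x = 0} = {x. \<forall>y \<in> span (rows A). orthogonal y x}"
  proof (intro set_eqI iffI; clarsimp)
    fix x y assume "A *v x = 0" "y \<in> span (rows A)"
    then show "orthogonal y x"
      using orthogonal_nullspace_rowspace orthogonal_commute by blast
  next
    fix x assume x: "\<forall>y \<in> span (rows A). orthogonal y x"
    have "A $ i \<in> span (rows A)" for i
      by (rule span_base) (auto simp: rows_def row_def)
    then show "A *v x = 0"
      using x by (auto simp: vec_eq_iff matrix_vector_mul_component orthogonal_def)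
  qed
  then show ?thesis
    using dim_subspace_orthogonal_to_vectors[of "span (rows A)" "UNIV :: (real ^ 'n) set"]
    by (simp add: row_rank_def subspace_span)
qed

text \<open>
  The vectors \<open>x i\<close> are the columns of the orthogonal projection \<open>P\<close> onto \<open>S\<close>: the second property
  is the diagonal of the identity \<open>P\<^sup>T P = P\<close>, and the third says that the trace of \<open>P\<close> is the
  dimension of \<open>S\<close>.
\<close>

lemma orthogonal_projection_columns:
  fixes S :: "(real ^ 'n) set"
  assumes "subspace S"
  obtains x :: "'n \<Rightarrow> real ^ 'n"
  where "\<And>i. x i \<in> S" and "\<And>i. x i $ i = x i \<bullet> x i" and "(\<Sum>i\<in>UNIV. x i $ i) = real (dim S)"
proof -
  obtain B where B: "B \<subseteq> S" "pairwise orthogonal B" "\<And>b. b \<in> B \<Longrightarrow> norm b = 1"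
      "independent B" "card B = dim S"
    using orthonormal_basis_subspace[OF assms] by metis
  have fin: "finite B"
    using B(4) by (rule independent_imp_finite)
  define x :: "'n \<Rightarrow> real ^ 'n" where "x i = (\<Sum>b\<in>B. (b $ i) *\<^sub>R b)" for i
  have orthonormal: "b \<bullet> b' = (if b = b' then 1 else 0)" if "b \<in> B" "b' \<in> B" for b b'
    using B(2,3) that by (auto simp: pairwise_def orthogonal_def norm_eq_1)
  show thesis
  proof
    show "x i \<in> S" for i
      unfolding x_def using assms B(1) by (intro subspace_sum subspace_scale) auto
    have diag: "x i $ i = (\<Sum>b\<in>B. (b $ i)\<^sup>2)" for i
      by (simp add: x_def power2_eq_square)
    have "x i \<bullet> x i = (\<Sum>b\<in>B. \<Sum>b'\<in>B. (b $ i) * (b' $ i) * (b \<bullet> b'))" for i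
      by (simp add: x_def inner_sum_left inner_sum_right sum_distrib_left mult_ac inner_commute)
    also have "\<dots> i = (\<Sum>b\<in>B. \<Sum>b'\<in>B. if b = b' then (b $ i)\<^sup>2 else 0)" for i
      by (intro sum.cong refl) (auto simp: orthonormal power2_eq_square)
    also have "\<dots> i = x i $ i" for i
      using fin by (simp add: diag)
    finally show "x i $ i = x i \<bullet> x i" for i
      by simp
    have "(\<Sum>i\<in>UNIV. x i $ i) = (\<Sum>b\<in>B. \<Sum>i\<in>UNIV. (b $ i)\<^sup>2)"
      by (simp add: diag sum.swap[of _ B])
    also have "\<dots> = (\<Sum>b\<in>B. b \<bullet> b)"
      by (simp add: inner_vec_def power2_eq_square)
    also have "\<dots> = real (dim S)"
      by (simp add: orthonormal B(5))
    finally show "(\<Sum>i\<in>UNIV. x i $ i) = real (dim S)" .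
  qed
qed

text \<open>
  With \<open>A $ i $ i = 1\<close>, row \<open>i\<close> of \<open>A *v x = 0\<close> expresses \<open>x $ i\<close> through the other coordinates of
  \<open>x\<close>, whose squares add up to \<open>x $ i - (x $ i)\<^sup>2\<close>; the rest is the Cauchy-Schwarz inequality.
  The relation \<open>x $ i = x \<bullet> x\<close> is the one satisfied by column \<open>i\<close> of a projection.
\<close>

lemma kernel_vector_row_bound:
  fixes A :: "real ^ 'n ^ 'n"
  assumes kernel: "A *v x = 0" and one: "A $ i $ i = 1" and diag: "x $ i = x \<bullet> x"
  shows "0 \<le> x $ i" and "x $ i < 1"
    and "x $ i / (1 - x $ i) \<le> (\<Sum>j\<in>- {i}. (A $ i $ j)\<^sup>2)"
proof -
  let ?u = "x $ i" and ?s = "\<Sum>j\<in>- {i}. (A $ i $ j)\<^sup>2"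
  have split: "(\<Sum>j\<in>UNIV. g j) = g i + (\<Sum>j\<in>- {i}. g j)" for g :: "'n \<Rightarrow> real"
    using sum.remove[of UNIV i g] by (simp add: Compl_eq_Diff_UNIV)
  have "A $ i \<bullet> x = 0"
    using kernel matrix_vector_mul_component[of A x i] by simp
  then have row: "?u = - (\<Sum>j\<in>- {i}. A $ i $ j * x $ j)"
    using split[of "\<lambda>j. A $ i $ j * x $ j"] one by (simp add: inner_vec_def)
  have off_diag: "(\<Sum>j\<in>- {i}. (x $ j)\<^sup>2) = ?u - ?u\<^sup>2"
    using split[of "\<lambda>j. (x $ j)\<^sup>2"] diag by (simp add: inner_vec_def power2_eq_square)
  have cs: "?u\<^sup>2 \<le> ?s * (?u - ?u\<^sup>2)"
    using Cauchy_Schwarz_ineq_sum[of "\<lambda>j. A $ i $ j" "\<lambda>j. x $ j" "- {i}"] row off_diag by simp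
  show nonneg: "0 \<le> ?u"
    using diag by simp
  have "0 \<le> ?u - ?u\<^sup>2"
    unfolding off_diag[symmetric] by (simp add: sum_nonneg)
  then have "?u \<le> 1"
    using nonneg by (cases "?u = 0") (auto simp: power2_eq_square mult_le_cancel_left1 less_le)
  moreover have "?u \<noteq> 1"
    using cs by auto
  ultimately show less: "?u < 1"
    by simp
  show "?u / (1 - ?u) \<le> ?s"
  proof (cases "?u = 0")
    case True
    then show ?thesis by (simp add: sum_nonneg)
  next
    case False
    have "?u * ?u \<le> ?u * (?s * (1 - ?u))"
      using cs by (simp add: power2_eq_square algebra_simps)
    then have "?u \<le> ?s * (1 - ?u)"
      using False nonneg by simp
    then show ?thesis
      using less by (simp add: pos_divide_le_eq)
  qed
qed

section \<open>Existence of the minimum\<close>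

text \<open>
  The admissible set is not closed because \<open>c\<close> is excluded.  If \<open>V\<close> is the value at the uniform
  weights, then \<open>f_cp c p t \<le> V\<close> with \<open>0 \<le> t < c\<close> forces \<open>t \<le> b\<close> for a constant \<open>b < c\<close>.  The admissible weights
  with all entries at most \<open>b\<close> form a nonempty compact set, and outside it a single term of the
  sum already exceeds \<open>V\<close>.
\<close>

lemma f_cp_sum_attains_minimum:
  fixes c p :: real
  assumes p: "p > 0" and c: "c > 1 / real CARD('n)"
  defines "D \<equiv> {t :: real ^ 'n. (\<Sum>i\<in>UNIV. t $ i) = 1 \<and> (\<forall>i. t $ i \<in> {0..<c})}"
  shows "\<exists>s\<in>D. \<forall>t\<in>D. (\<Sum>i\<in>UNIV. f_cp c p (s $ i)) \<le> (\<Sum>i\<in>UNIV. f_cp c p (t $ i))"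
proof -
  define F where "F = (\<lambda>t :: real ^ 'n. \<Sum>i\<in>UNIV. f_cp c p (t $ i))"
  define u :: "real ^ 'n" where "u = (\<chi> i. 1 / real CARD('n))"
  define W where "W = F u powr (2 / p)"
  \<comment> \<open>The solution \<open>b\<close> of \<open>b / (c - b) = W\<close>, at which a single term equals \<open>F u\<close>.\<close>
  define b where "b = c * W / (1 + W)"
  define K where "K = {t :: real ^ 'n. (\<Sum>i\<in>UNIV. t $ i) = 1 \<and> (\<forall>i. t $ i \<in> {0..b})}"
  have c0: "c > 0"
    using c by (meson less_trans zero_less_divide_1_iff of_nat_0_less_iff zero_less_card_finite)
  have W: "W \<ge> 0"
    by (simp add: W_def)
  have f_nonneg: "f_cp c p r \<ge> 0" for r
    by (simp add: f_cp_def)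
  have F_nonneg: "F t \<ge> 0" for t
    by (simp add: F_def sum_nonneg f_nonneg)
  have b: "b < c"
    using c0 W by (simp add: b_def field_simps)
  have uD: "u \<in> D"
    using c by (auto simp: D_def u_def)
  have in_K: "t \<in> K" if t: "t \<in> D" and le: "F t \<le> F u" for t
  proof -
    have "t $ i \<le> b" for i
    proof -
      have ti: "0 \<le> t $ i" "t $ i < c"
        using t by (auto simp: D_def)
      have "(t $ i / (c - t $ i)) powr (p / 2) \<le> F t"
        unfolding F_def using member_le_sum[of i UNIV "\<lambda>i. f_cp c p (t $ i)"] f_nonneg
        by (simp add: f_cp_def)
      then have "((t $ i / (c - t $ i)) powr (p / 2)) powr (2 / p) \<le> W"
        unfolding W_def using le p by (intro powr_mono2) auto
      then have "t $ i / (c - t $ i) \<le> W"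
        using ti p by (simp add: powr_powr)
      then show ?thesis
        using ti W by (simp add: b_def field_simps)
    qed
    then show ?thesis
      using t by (auto simp: K_def D_def)
  qed
  have uK: "u \<in> K"
    by (rule in_K[OF uD]) simp
  have KD: "K \<subseteq> D"
    using b by (auto simp: K_def D_def intro: le_less_trans)
  have "K = {t. (\<Sum>i\<in>UNIV. t $ i) = 1} \<inter> cbox 0 (\<chi> i. b)"
    by (auto simp: K_def mem_box_cart)
  moreover have "closed {t :: real ^ 'n. (\<Sum>i\<in>UNIV. t $ i) = 1}"
    by (intro closed_Collect_eq continuous_intros)
  ultimately have compact: "compact K"
    by (simp add: closed_Int_compact)
  have in_range: "0 \<le> t $ i" "t $ i < c" if "t \<in> K" for t i
    using KD that by (auto simp: D_def)
  have cont: "continuous_on K F"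
    unfolding F_def f_cp_def
  proof (intro continuous_on_sum continuous_on_powr' ballI)
    show "continuous_on K (\<lambda>t. t $ i / (c - t $ i))" for i
      using in_range by (intro continuous_intros) force
    show "0 \<le> t $ i / (c - t $ i) \<and> (t $ i / (c - t $ i) = 0 \<longrightarrow> 0 < p / 2)"
      if "t \<in> K" for t i
      using in_range[OF that, of i] p by simp
  qed (rule continuous_on_const)
  obtain s where s: "s \<in> K" "\<forall>t\<in>K. F s \<le> F t"
    using continuous_attains_inf[OF compact _ cont] uK by auto
  have "F s \<le> F t" if "t \<in> D" for t
  proof (cases "F t \<le> F u")
    case True
    then show ?thesis
      using s(2) in_K[OF that] by blast
  next
    case False
    then show ?thesis
      using s(2) uK by force
  qed
  then show ?thesis
    using s(1) KD unfolding F_def by auto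
qed

lemma M_min_le:
  fixes t :: "'n::finite \<Rightarrow> real"
  assumes p: "p > 0" and c: "c > 1 / real CARD('n)"
    and t: "(\<Sum>i\<in>UNIV. t i) = 1" "\<And>i. t i \<in> {0..<c}"
  shows "M_min c p CARD('n) \<le> (\<Sum>i\<in>UNIV. f_cp c p (t i))"
proof -
  obtain s :: "real ^ 'n" where s: "(\<Sum>i\<in>UNIV. s $ i) = 1" "\<And>i. s $ i \<in> {0..<c}"
    and s_min: "\<And>r :: 'n \<Rightarrow> real. (\<Sum>i\<in>UNIV. r i) = 1 \<Longrightarrow> (\<And>i. r i \<in> {0..<c}) \<Longrightarrow>
      (\<Sum>i\<in>UNIV. f_cp c p (s $ i)) \<le> (\<Sum>i\<in>UNIV. f_cp c p (r i))"
  proof -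
    obtain s :: "real ^ 'n" where s: "(\<Sum>i\<in>UNIV. s $ i) = 1" "\<And>i. s $ i \<in> {0..<c}"
      and s_le: "\<And>r :: real ^ 'n. (\<Sum>i\<in>UNIV. r $ i) = 1 \<Longrightarrow> (\<And>i. r $ i \<in> {0..<c}) \<Longrightarrow>
        (\<Sum>i\<in>UNIV. f_cp c p (s $ i)) \<le> (\<Sum>i\<in>UNIV. f_cp c p (r $ i))"
      using f_cp_sum_attains_minimum[OF p c] by blast
    show thesis
      using that[OF s] s_le[of "vec_lambda _"] by simp
  qed
  obtain h :: "nat \<Rightarrow> 'n" where h: "bij_betw h {1..CARD('n)} UNIV"
    using ex_bij_betw_nat_finite_1[of "UNIV :: 'n set"] by auto
  have h_inv: "bij_betw (inv_into {1..CARD('n)} h) UNIV {1..CARD('n)}"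
    using h by (rule bij_betw_inv_into)
  have "M_min c p CARD('n) = (\<Sum>i\<in>UNIV. f_cp c p (s $ i))"
    unfolding M_min_def
  proof (rule Least_equality, goal_cases)
    case 1
    have "(\<Sum>i = 1..CARD('n). s $ h i) = 1"
      using sum.reindex_bij_betw[OF h, of "\<lambda>i. s $ i"] s(1) by simp
    moreover have "(\<Sum>i = 1..CARD('n). f_cp c p (s $ h i)) = (\<Sum>i\<in>UNIV. f_cp c p (s $ i))"
      by (rule sum.reindex_bij_betw[OF h])
    ultimately show ?case
      using s(2) by (auto intro!: exI[of _ "\<lambda>i. s $ h i"])
  next
    case (2 v)
    then obtain r :: "nat \<Rightarrow> real" where v: "v = (\<Sum>i = 1..CARD('n). f_cp c p (r i))"
      and r: "(\<Sum>i = 1..CARD('n). r i) = 1" "\<And>i. i \<in> {1..CARD('n)} \<Longrightarrow> r i \<in> {0..<c}"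
      by auto
    let ?g = "inv_into {1..CARD('n)} h"
    have "(\<Sum>i\<in>UNIV. f_cp c p (s $ i)) \<le> (\<Sum>i\<in>UNIV. f_cp c p (r (?g i)))"
    proof (rule s_min)
      show "(\<Sum>i\<in>UNIV. r (?g i)) = 1"
        using sum.reindex_bij_betw[OF h_inv, of r] r(1) by simp
      show "r (?g i) \<in> {0..<c}" for i
        using r(2) bij_betwE[OF h_inv] by blast
    qed
    also have "\<dots> = v"
      unfolding v by (rule sum.reindex_bij_betw[OF h_inv])
    finally show ?case .
  qed
  then show ?thesis
    using s_min[of t] t by simp
qed

section \<open>The energy bound\<close>

lemma frame_energy_eq_row_sums:
  fixes A :: "real ^ 'n ^ 'n"
  shows "frame_energy p A = (\<Sum>i\<in>UNIV. \<Sum>j\<in>- {i}. ((A $ i $ j)\<^sup>2) powr (p / 2))"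
proof -
  have "{(i, j). i \<noteq> j} = (SIGMA i:(UNIV :: 'n set). - {i})"
    by auto
  then have "frame_energy p A = (\<Sum>i\<in>UNIV. \<Sum>j\<in>- {i}. \<bar>A $ i $ j\<bar> powr p)"
    by (simp add: frame_energy_def sum.Sigma)
  moreover have "\<bar>z\<bar> powr p = z\<^sup>2 powr (p / 2)" for z :: real
  proof -
    have "z\<^sup>2 = \<bar>z\<bar> powr 2"
      by simp
    then show ?thesis
      by (simp only: powr_powr) simp
  qed
  ultimately show ?thesis
    by simp
qed

text \<open>
  This is the heart of the estimate, valid for every \<open>p > 0\<close>; only the passage from row sums of
  squares to the energy depends on the position of \<open>p\<close> relative to \<open>2\<close>.
\<close>

lemma M_min_le_row_square_sums:
  fixes A :: "real ^ 'n ^ 'n"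
  assumes d: "CARD('n) \<ge> d + 1" and rank: "rank A = d" and one: "\<And>i. A $ i $ i = 1" and p: "p > 0"
  shows "M_min (1 / (real CARD('n) - real d)) p CARD('n)
    \<le> (\<Sum>i\<in>UNIV. (\<Sum>j\<in>- {i}. (A $ i $ j)\<^sup>2) powr (p / 2))"
proof -
  define k where "k = real CARD('n) - real d"
  have k: "k > 0"
    using d by (simp add: k_def)
  have sub: "subspace {x. A *v x = 0}"
    by (simp add: subspace_def matrix_vector_right_distrib matrix_vector_mult_scaleR)
  have dim: "real (dim {x. A *v x = 0}) = k"
    using dim_kernel_plus_rank[of A] rank by (simp add: k_def)
  obtain x :: "'n \<Rightarrow> real ^ 'n" where x: "\<And>i. x i \<in> {x. A *v x = 0}" "\<And>i. x i $ i = x i \<bullet> x i"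
    and trace: "(\<Sum>i\<in>UNIV. x i $ i) = real (dim {x. A *v x = 0})"
    using orthogonal_projection_columns[OF sub] by blast
  note trace = trace[unfolded dim]
  note bounds = kernel_vector_row_bound[OF x(1)[unfolded mem_Collect_eq] one x(2)]
  \<comment> \<open>The diagonal entries are less than \<open>1\<close>, hence so is their mean \<open>k / CARD('n)\<close>.\<close>
  have "k < real CARD('n)"
    using sum_strict_mono[of UNIV "\<lambda>i. x i $ i" "\<lambda>_. 1"] bounds(2) trace by simp
  then have "1 / k > 1 / real CARD('n)"
    using k by (simp add: field_simps)
  then have "M_min (1 / k) p CARD('n) \<le> (\<Sum>i\<in>UNIV. f_cp (1 / k) p (x i $ i / k))"
  proof (rule M_min_le[OF p])
    show "(\<Sum>i\<in>UNIV. x i $ i / k) = 1"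
      using trace k by (simp flip: sum_divide_distrib)
    show "x i $ i / k \<in> {0..<1 / k}" for i
      using bounds(1,2)[of i] k by (simp add: divide_strict_right_mono)
  qed
  also have "\<dots> = (\<Sum>i\<in>UNIV. (x i $ i / (1 - x i $ i)) powr (p / 2))"
    using k by (simp add: f_cp_def flip: diff_divide_distrib)
  also have "\<dots> \<le> (\<Sum>i\<in>UNIV. (\<Sum>j\<in>- {i}. (A $ i $ j)\<^sup>2) powr (p / 2))"
  proof (rule sum_mono)
    fix i :: 'n
    show "(x i $ i / (1 - x i $ i)) powr (p / 2) \<le> (\<Sum>j\<in>- {i}. (A $ i $ j)\<^sup>2) powr (p / 2)"
      using bounds[of i] p by (intro powr_mono2) simp_all
  qed
  finally show ?thesis
    by (simp add: k_def)
qed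

theorem lemma2p2:
  fixes A :: "real ^ 'n ^ 'n" and d :: nat and p :: real
  assumes "CARD('n) \<ge> d + 1"
    and "rank A = d"
    and "\<forall>i. A $ i $ i = 1"
  shows "(1 \<le> p \<and> p \<le> 2 \<longrightarrow>
            frame_energy p A \<ge> M_min (1 / (real CARD('n) - real d)) p CARD('n)) \<and>
         (p \<ge> 2 \<longrightarrow>
            frame_energy p A \<ge> (real CARD('n) - 1) powr (1 - p / 2)
                                * M_min (1 / (real CARD('n) - real d)) p CARD('n))"
proof (intro conjI impI)
  let ?M = "M_min (1 / (real CARD('n) - real d)) p CARD('n)"
  let ?R = "\<Sum>i\<in>UNIV. (\<Sum>j\<in>- {i}. (A $ i $ j)\<^sup>2) powr (p / 2)"
  have M_le: "?M \<le> ?R" if "p > 0"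
    using M_min_le_row_square_sums assms that by blast
  {
    assume p: "1 \<le> p \<and> p \<le> 2"
    have "?R \<le> frame_energy p A"
      unfolding frame_energy_eq_row_sums using p by (intro sum_mono powr_sum_le_sum_powr) auto
    then show "frame_energy p A \<ge> ?M"
      using M_le p by simp
  next
    assume p: "p \<ge> 2"
    let ?m = "real CARD('n) - 1"
    have card: "real (card (- {i})) = ?m" for i :: 'n
      by (simp add: Compl_eq_Diff_UNIV of_nat_diff Suc_le_eq)
    have "?R \<le> (\<Sum>i\<in>UNIV. ?m powr (p / 2 - 1) * (\<Sum>j\<in>- {i}. ((A $ i $ j)\<^sup>2) powr (p / 2)))"
    proof (rule sum_mono)
      fix i :: 'n
      show "(\<Sum>j\<in>- {i}. (A $ i $ j)\<^sup>2) powr (p / 2)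
          \<le> ?m powr (p / 2 - 1) * (\<Sum>j\<in>- {i}. ((A $ i $ j)\<^sup>2) powr (p / 2))"
        unfolding card[of i, symmetric] using p
        by (intro powr_sum_le_card_mult_sum_powr) auto
    qed
    then have "?R \<le> ?m powr (p / 2 - 1) * frame_energy p A"
      by (simp add: frame_energy_eq_row_sums sum_distrib_left)
    then have "?m powr (1 - p / 2) * ?M \<le> ?m powr (1 - p / 2) * (?m powr (p / 2 - 1) * frame_energy p A)"
      using M_le p by (intro mult_left_mono) auto
    also have "\<dots> = ?m powr 0 * frame_energy p A"
      by (simp flip: powr_add mult.assoc)
    \<comment> \<open>An inequality, since \<open>?m powr 0\<close> is \<open>0\<close> for \<open>?m = 0\<close>.\<close>
    also have "\<dots> \<le> frame_energy p A"
      by (cases "?m = 0") (auto simp: frame_energy_eq_row_sums intro!: sum_nonneg)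
    finally show "frame_energy p A \<ge> ?m powr (1 - p / 2) * ?M" .
  }
qed

end
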